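(* Let $X$ be a block gluing $\mathbb{Z}^d$ shift and let $L\subsetneq\mathbb{Z}^d$ be any $1$-dimensional sublattice. Then $h_{\mathrm{top}}(X)=h_L(X)$ if and only if $X=(X_L)^{\mathbb{Z}^{d-1}}$.
   Context: For a finite alphabet $\mathcal{A}$ let $\mathcal{A}^{\mathbb{Z}^d}$ carry the product topology and the shift action $(\sigma_{\vec\imath}(x))_{\vec\jmath}=x_{\vec\imath+\vec\jmath}$. A $\mathbb{Z}^d$ shift is a closed $\sigma$-invariant subset $X\subseteq\mathcal{A}^{\mathbb{Z}^d}$ (not assumed to be of finite type). For finite $F\subsetneq\mathbb{Z}^d$ put $\mathcal{L}_F(X)=\{x|_F\mid x\in X\}$. Topological entropy: $h_{\mathrm{top}}(X)=\lim_{n\to\infty}\frac{\log|\mathcal{L}_{C_n}(X)|}{|C_n|}$ with $C_n=\{\vec\imath\in\mathbb{Z}^d\mid\|\vec\imath\|_\infty\le n\}$. A block is a set $[\vec u,\vec v]=\{\vec\imath\in\mathbb{Z}^d\mid\vec u_k\le\vec\imath_k\le\vec v_k\ \forall\,1\le k\le d\}$. $X$ is block gluing if there exists a constant $g\in\mathbb{N}_0$ such that whenever two blocks $B_1,B_2\subsetneq\mathbb{Z}^d$ have distance (in the maximum metric) larger than $g$, then for any $P_1\in\mathcal{L}_{B_1}(X)$ and $P_2\in\mathcal{L}_{B_2}(X)$ there exists $x\in X$ with $x|_{B_1}=P_1$ and $x|_{B_2}=P_2$. Sublattices (here $d\ge2$): let $\vec u,\vec v^{(1)},\dots,\vec v^{(d-1)}\in\mathbb{Z}^d$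 be linearly independent with integer span equal to $\mathbb{Z}^d$. Then $L=\langle\vec u\rangle_{\mathbb{Z}}$ is called a $1$-dimensional sublattice of $\mathbb{Z}^d$ and $L'=\langle\vec v^{(1)},\dots,\vec v^{(d-1)}\rangle_{\mathbb{Z}}$ a complementary sublattice. $X_L=\{x|_L\mid x\in X\}$ is regarded as a $\mathbb{Z}$ shift via the isomorphism $L\cong\mathbb{Z}$, $j\vec u\mapsto j$, and the $L$-projectional entropy of $X$ is $h_L(X)=h_{\mathrm{top}}(X_L)$ (entropy as a $\mathbb{Z}$ shift). $(X_L)^{\mathbb{Z}^{d-1}}$ is the $\mathbb{Z}^d$ shift of all $x\in\mathcal{A}^{\mathbb{Z}^d}$ such that for every $\vec w\in L'$ the configuration $(x_{\vec t+\vec w})_{\vec t\in L}$ belongs to $X_L$ (this does not depend on the choice of $L'$). *)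

theory Defs
  imports "HOL-Analysis.Analysis" "HOL-Library.Extended_Nat"
begin

(* Z^d is the type int^'d, with d = CARD('d). *)

definition shift :: "int^'d \<Rightarrow> (int^'d \<Rightarrow> 'a) \<Rightarrow> (int^'d \<Rightarrow> 'a)" where
  "shift i x = (\<lambda>j. x (i + j))"

(* closedin includes X being a subset of the topspace, i.e. every configuration in X takes its
   values in the alphabet A. *)
definition is_shift :: "'a set \<Rightarrow> (int^'d \<Rightarrow> 'a) set \<Rightarrow> bool" where
  "is_shift A X \<longleftrightarrow>
     closedin (product_topology (\<lambda>_. discrete_topology A) UNIV) X \<and> (\<forall>i. shift i ` X \<subseteq> X)"

(* The set of all x|_F with x in X, restrictions being encoded as extensional functions on F.
   For finite F this is the language L_F(X); for a sublattice L it is X_L. *)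
definition restrictions :: "(int^'d) set \<Rightarrow> (int^'d \<Rightarrow> 'a) set \<Rightarrow> (int^'d \<Rightarrow> 'a) set" where
  "restrictions F X = (\<lambda>x. restrict x F) ` X"

definition max_norm :: "int^'d \<Rightarrow> nat" where
  "max_norm i = Max (range (\<lambda>k. nat \<bar>i $ k\<bar>))"

definition cube :: "nat \<Rightarrow> (int^'d) set" where
  "cube n = {i. max_norm i \<le> n}"

(* For empty X, ln 0 = 0 gives the value 0 in every dimension (instead of -\<infinity>). *)
definition h_top :: "(int^'d \<Rightarrow> 'a) set \<Rightarrow> real" where
  "h_top X = lim (\<lambda>n. ln (real (card (restrictions (cube n) X)))
                       / real (card (cube n :: (int^'d) set)))"

definition block :: "int^'d \<Rightarrow> int^'d \<Rightarrow> (int^'d) set" where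
  "block u v = {i. \<forall>k. u $ k \<le> i $ k \<and> i $ k \<le> v $ k}"

definition max_dist :: "(int^'d) set \<Rightarrow> (int^'d) set \<Rightarrow> enat" where
  "max_dist B1 B2 = (INF (i, j) \<in> B1 \<times> B2. enat (max_norm (i - j)))"

definition block_gluing :: "(int^'d \<Rightarrow> 'a) set \<Rightarrow> bool" where
  "block_gluing X \<longleftrightarrow>
     (\<exists>g::nat. \<forall>u1 v1 u2 v2. enat g < max_dist (block u1 v1) (block u2 v2) \<longrightarrow>
        (\<forall>P1 \<in> restrictions (block u1 v1) X. \<forall>P2 \<in> restrictions (block u2 v2) X.
           \<exists>x\<in>X. restrict x (block u1 v1) = P1 \<and> restrict x (block u2 v2) = P2))"

interpretation int_vec: module "(*s) :: int \<Rightarrow> int^'d \<Rightarrow> int^'d"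
  by unfold_locales (simp_all add: vec_eq_iff algebra_simps)

(* L is the 1-dimensional sublattice generated by u, and L' is a complementary sublattice;
   V is the set of the d-1 vectors v^(1), ..., v^(d-1). Spans and independence are over the
   integers. *)
definition complementary_sublattices :: "int^'d \<Rightarrow> (int^'d) set \<Rightarrow> (int^'d) set \<Rightarrow> bool" where
  "complementary_sublattices u L L' \<longleftrightarrow>
     (\<exists>V. finite V \<and> card V = CARD('d) - 1 \<and> u \<notin> V \<and>
          int_vec.independent (insert u V) \<and> int_vec.span (insert u V) = UNIV \<and>
          L = int_vec.span {u} \<and> L' = int_vec.span V)"

(* Transport along the isomorphism from L to Z sending j u to j; Z is the type int^1. *)
definition as_Z_shift :: "int^'d \<Rightarrow> (int^'d \<Rightarrow> 'a) set \<Rightarrow> (int^1 \<Rightarrow> 'a) set" where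
  "as_Z_shift u Y = (\<lambda>y. \<lambda>j. y ((j $ 1) *s u)) ` Y"

definition proj_entropy :: "int^'d \<Rightarrow> (int^'d) set \<Rightarrow> (int^'d \<Rightarrow> 'a) set \<Rightarrow> real" where
  "proj_entropy u L X = h_top (as_Z_shift u (restrictions L X))"

(* The Z^d shift Y^(Z^(d-1)), for a set Y of configurations on L. *)
definition full_extension ::
    "'a set \<Rightarrow> (int^'d) set \<Rightarrow> (int^'d) set \<Rightarrow> (int^'d \<Rightarrow> 'a) set \<Rightarrow> (int^'d \<Rightarrow> 'a) set" where
  "full_extension A L L' Y =
     {x. range x \<subseteq> A \<and> (\<forall>w\<in>L'. restrict (\<lambda>t. x (t + w)) L \<in> Y)}"

end

theory Submission
  imports Defs "HOL-Real_Asymp.Real_Asymp"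
begin

text \<open>
  If a finite set \<open>S\<close> tiles \<open>\<int>\<^sup>d\<close> by translations, then covering large cubes by translates of \<open>S\<close> gives
  \<open>h_top X \<le> ln N(S) / |S|\<close>, where \<open>N(S)\<close> is the number of patterns of \<open>X\<close> on \<open>S\<close>. Taking cubes for \<open>S\<close>
  shows that the limit defining the entropy exists, and taking segments of \<open>L\<close> gives \<open>h_top X \<le> h_L X\<close>.
  If \<open>X\<close> is the full extension of \<open>X_L\<close>, the patterns of \<open>X\<close> on a cube are arbitrary products of patterns
  on parallel segments, so there are at least \<open>exp (h_L X \<cdot> |cube|)\<close> of them.

  Conversely, the full extension \<open>Y\<close> has the same projectional entropy as \<open>X\<close>. If \<open>X \<noteq> Y\<close>, some pattern of
  \<open>Y\<close> on a cube is missing in \<open>X\<close>. Block gluing of \<open>X\<close> along single lines allows this pattern to be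
  planted anywhere in a configuration of \<open>Y\<close>, changing only a neighbourhood of bounded size. Hence
  forbidding the pattern at one more of a positive density of places loses a fixed fraction of the
  patterns of \<open>Y\<close>, and \<open>h_top X < h_top Y \<le> h_L Y = h_L X\<close>.
\<close>

section \<open>Cubes and blocks in \<open>int^'d\<close>: finiteness, size and growth\<close>

lemma mem_cube: "i \<in> cube n \<longleftrightarrow> (\<forall>k. \<bar>i $ k\<bar> \<le> int n)"
  unfolding cube_def max_norm_def by (auto simp: nat_le_iff)

lemma cube_eq_block: "cube n = block (\<chi> k. - int n) (\<chi> k. int n)"
  unfolding block_def by (auto simp: mem_cube abs_le_iff minus_le_iff)

lemma block_eq_image:
  "block u v = vec_lambda ` (PiE UNIV (\<lambda>k. {u $ k..v $ k}))"
proof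
  show "block u v \<subseteq> vec_lambda ` (PiE UNIV (\<lambda>k. {u $ k..v $ k}))"
  proof
    fix i assume "i \<in> block u v"
    then have "i = vec_lambda (($) i)" "($) i \<in> PiE UNIV (\<lambda>k. {u $ k..v $ k})"
      by (auto simp: block_def)
    then show "i \<in> vec_lambda ` (PiE UNIV (\<lambda>k. {u $ k..v $ k}))" by blast
  qed
qed (auto simp: block_def)

lemma finite_block: "finite (block u v)"
  unfolding block_eq_image by (intro finite_imageI finite_PiE) auto

lemma finite_cube: "finite (cube n)"
  unfolding cube_eq_block by (rule finite_block)

lemma card_block: "card (block u v) = (\<Prod>k\<in>UNIV. nat (v $ k - u $ k + 1))"
proof -
  have "inj_on vec_lambda (PiE UNIV (\<lambda>k. {u $ k..v $ k}))"
    by (rule inj_onI) (metis UNIV_I vec_lambda_inject)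
  then show ?thesis
    unfolding block_eq_image by (simp add: card_image card_PiE)
qed

lemma card_cube: "card (cube n :: (int^'d) set) = (2 * n + 1) ^ CARD('d)"
proof -
  have "nat (2 * int n + 1) = 2 * n + 1" by linarith
  then show ?thesis
    unfolding cube_eq_block card_block by simp
qed

lemma zero_in_cube: "0 \<in> cube n"
  by (simp add: mem_cube)

lemma card_cube_pos: "card (cube n) > 0"
  using zero_in_cube finite_cube card_gt_0_iff by blast

lemma cube_mono: "m \<le> n \<Longrightarrow> cube m \<subseteq> cube n"
  unfolding cube_def by auto

lemma cube_add: "i \<in> cube m \<Longrightarrow> j \<in> cube n \<Longrightarrow> i + j \<in> cube (m + n)"
  unfolding mem_cube by (auto intro!: order_trans[OF abs_triangle_ineq] add_mono)

lemma cube_minus: "i \<in> cube m \<Longrightarrow> - i \<in> cube m"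
  unfolding mem_cube by simp

lemma cube_diff: "i \<in> cube m \<Longrightarrow> j \<in> cube n \<Longrightarrow> i - j \<in> cube (m + n)"
  using cube_add cube_minus by fastforce

lemma finite_subset_cube:
  assumes "finite S" obtains r where "S \<subseteq> cube r"
proof
  show "S \<subseteq> cube (Max (insert 0 (max_norm ` S)))"
    unfolding cube_def using assms by auto
qed

text \<open>The boundary layer of a cube has negligible volume. Every estimate that enlarges a cube
  by a fixed margin is harmless in the limit for this reason.\<close>

lemma card_cube_ratio_tendsto:
  "(\<lambda>n. real (card (cube (n + c) :: (int^'d) set)) / real (card (cube n :: (int^'d) set))) \<longlonglongrightarrow> 1"
proof -
  have "(\<lambda>n. real (2 * (n + c) + 1) / real (2 * n + 1)) \<longlonglongrightarrow> 1"
    by real_asymp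
  then have "(\<lambda>n. (real (2 * (n + c) + 1) / real (2 * n + 1)) ^ CARD('d)) \<longlonglongrightarrow> 1 ^ CARD('d)"
    by (rule tendsto_power)
  then show ?thesis
    by (simp add: card_cube power_divide)
qed

section \<open>Counting images of maps, and restricted configurations\<close>

lemma card_image_le_card:
  assumes "finite B" "f ` X \<subseteq> B" "\<And>x y. x \<in> X \<Longrightarrow> y \<in> X \<Longrightarrow> f x = f y \<Longrightarrow> g x = g y"
  shows "card (g ` X) \<le> card B"
proof (rule surj_card_le[OF assms(1)])
  show "g ` X \<subseteq> (\<lambda>b. g (SOME x. x \<in> X \<and> f x = b)) ` B"
  proof
    fix y assume "y \<in> g ` X"
    then obtain x where x: "x \<in> X" "y = g x" by blast
    then have "(SOME x'. x' \<in> X \<and> f x' = f x) \<in> X \<and> f (SOME x'. x' \<in> X \<and> f x' = f x) = f x"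
      by (intro someI_ex[of "\<lambda>x'. x' \<in> X \<and> f x' = f x"]) blast
    then have "y = g (SOME x'. x' \<in> X \<and> f x' = f x)"
      using assms(3)[OF _ x(1)] x(2) by simp
    then show "y \<in> (\<lambda>b. g (SOME x. x \<in> X \<and> f x = b)) ` B"
      using x assms(2) by blast
  qed
qed

lemma card_image_eq_card_image:
  assumes "\<And>x y. x \<in> X \<Longrightarrow> y \<in> X \<Longrightarrow> f x = f y \<longleftrightarrow> g x = g y"
  shows "card (f ` X) = card (g ` X)"
proof (rule bij_betw_same_card)
  show "bij_betw (\<lambda>b. g (SOME x. x \<in> X \<and> f x = b)) (f ` X) (g ` X)"
  proof -
    have *: "g (SOME x'. x' \<in> X \<and> f x' = f x) = g x" if "x \<in> X" for x
      using someI_ex[of "\<lambda>x'. x' \<in> X \<and> f x' = f x"] that assms by blast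
    then show ?thesis
      unfolding bij_betw_def inj_on_def using assms by (auto simp: image_image)
  qed
qed

lemma restrict_eq_iff: "restrict x F = restrict y F \<longleftrightarrow> (\<forall>i\<in>F. x i = y i)"
  by (auto simp: restrict_def fun_eq_iff)

lemma restrictionsI: "x \<in> X \<Longrightarrow> restrict x F \<in> restrictions F X"
  unfolding restrictions_def by (rule imageI)

lemma restrictionsE:
  assumes "q \<in> restrictions F X"
  obtains x where "x \<in> X" "q = restrict x F"
  using assms unfolding restrictions_def by (metis imageE)

lemma restrictions_mono: "X \<subseteq> Y \<Longrightarrow> restrictions F X \<subseteq> restrictions F Y"
  unfolding restrictions_def by (rule image_mono)

section \<open>Tilings by translates of a finite set\<close>

definition tiles :: "(int^'d) set \<Rightarrow> (int^'d) set \<Rightarrow> bool" where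
  "tiles S T \<longleftrightarrow> finite S \<and> S \<noteq> {} \<and> (\<forall>i. \<exists>!t. t \<in> T \<and> i - t \<in> S)"

text \<open>This is division with remainder for \<open>i - a\<close> by the length of the interval.
  It supplies the tilings by blocks (one coordinate at a time) and by segments of
  \<open>L\<close>.\<close>

lemma interval_ex1_multiple:
  fixes a b i :: int
  assumes "a \<le> b"
  shows "\<exists>!t. (b - a + 1) dvd t \<and> i - t \<in> {a..b}"
proof (rule ex1I)
  let ?l = "b - a + 1"
  have "(i - a) mod ?l = i - a - (i - a) div ?l * ?l"
    by (simp add: minus_div_mult_eq_mod)
  moreover have "0 \<le> (i - a) mod ?l" using assms by simp
  moreover have "(i - a) mod ?l \<le> b - a"
    using assms pos_mod_bound[of ?l "i - a"] by linarith
  ultimately show "?l dvd (i - a) div ?l * ?l \<and> i - (i - a) div ?l * ?l \<in> {a..b}"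
    by auto
  fix t assume t: "?l dvd t \<and> i - t \<in> {a..b}"
  then obtain s where s: "t = s * ?l" by (metis dvd_def mult.commute)
  have "(i - a - t) div ?l = 0" using t by (intro div_pos_pos_trivial) auto
  moreover have "(i - a - t) div ?l = (i - a) div ?l - s"
    using assms div_mult_self1[of ?l "i - a" "- s"] by (simp add: s)
  ultimately show "t = (i - a) div ?l * ?l" using s by simp
qed

lemma tiles_block:
  assumes "\<And>k. u $ k \<le> v $ k"
  shows "tiles (block u v) {t. \<forall>k. (v $ k - u $ k + 1) dvd t $ k}"
  unfolding tiles_def
proof (intro conjI allI finite_block)
  have "u \<in> block u v" using assms by (simp add: block_def)
  then show "block u v \<noteq> {}" by blast
  fix i
  have "\<exists>s. (v $ k - u $ k + 1) dvd s \<and> i $ k - s \<in> {u $ k..v $ k}" for k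
    using interval_ex1_multiple[OF assms[of k], of "i $ k"] by (rule ex1_implies_ex)
  then obtain t where t: "\<And>k. (v $ k - u $ k + 1) dvd t k \<and> i $ k - t k \<in> {u $ k..v $ k}"
    by metis
  show "\<exists>!t. t \<in> {t. \<forall>k. (v $ k - u $ k + 1) dvd t $ k} \<and> i - t \<in> block u v"
  proof (rule ex1I)
    show "vec_lambda t \<in> {t. \<forall>k. (v $ k - u $ k + 1) dvd t $ k} \<and> i - vec_lambda t \<in> block u v"
      using t by (simp add: block_def)
    fix s assume "s \<in> {t. \<forall>k. (v $ k - u $ k + 1) dvd t $ k} \<and> i - s \<in> block u v"
    then have "(v $ k - u $ k + 1) dvd s $ k \<and> i $ k - s $ k \<in> {u $ k..v $ k}" for k
      by (simp add: block_def)
    then have "s $ k = t k" for k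
      using t interval_ex1_multiple[OF assms] by blast
    then show "s = vec_lambda t" by (simp add: vec_eq_iff)
  qed
qed

lemma tiles_cube: "\<exists>T. tiles (cube n) T"
  unfolding cube_eq_block by (rule exI, rule tiles_block) simp

text \<open>Uniqueness of the tile containing a point says that tiles are disjoint. This turns a
  number of tiles into a volume.\<close>

lemma inj_on_tiles:
  assumes "tiles S T" "K \<subseteq> T"
  shows "inj_on (\<lambda>(t, s). t + s) (K \<times> S)"
proof (rule inj_onI, clarify)
  fix t s t' s' assume *: "t \<in> K" "s \<in> S" "t' \<in> K" "s' \<in> S" "t + s = t' + s'"
  have "t \<in> T \<and> (t + s) - t \<in> S" "t' \<in> T \<and> (t' + s') - t' \<in> S"
    using *(1-4) assms(2) by auto
  then have "t = t'" using assms(1) *(5) unfolding tiles_def by metis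
  then show "t = t' \<and> s = s'" using * by simp
qed

text \<open>The tiles meeting \<open>cube n\<close> cover it. They stay inside a slightly larger
  cube and are disjoint, so their number is bounded by its volume.\<close>

lemma tiles_meeting_cube:
  fixes n :: nat and S T :: "(int^'d) set"
  assumes "tiles S T" "S \<subseteq> cube r"
  obtains K where "finite K" "K \<subseteq> T" "cube n \<subseteq> (\<Union>t\<in>K. (+) t ` S)"
    "card K * card S \<le> card (cube (n + (r + r)) :: (int^'d) set)"
proof
  let ?K = "{t \<in> T. \<exists>i\<in>cube n. i - t \<in> S}"
  have finS: "finite S" using assms(1) by (simp add: tiles_def)
  have "?K \<subseteq> (\<lambda>(i, s). i - s) ` (cube n \<times> S)"
  proof
    fix t assume "t \<in> ?K"
    then obtain i where "i \<in> cube n" "i - t \<in> S" by blast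
    then have "(i, i - t) \<in> cube n \<times> S" "t = (\<lambda>(i, s). i - s) (i, i - t)" by auto
    then show "t \<in> (\<lambda>(i, s). i - s) ` (cube n \<times> S)" by blast
  qed
  then show finK: "finite ?K"
    using finite_cube finS by (meson finite_SigmaI finite_imageI finite_subset)
  show "?K \<subseteq> T" by blast
  show "cube n \<subseteq> (\<Union>t\<in>?K. (+) t ` S)"
  proof
    fix i assume i: "i \<in> (cube n :: (int^'d) set)"
    obtain t where "t \<in> T" "i - t \<in> S" using assms(1) unfolding tiles_def by blast
    then have "t \<in> ?K" "i = t + (i - t)" using i by auto
    then show "i \<in> (\<Union>t\<in>?K. (+) t ` S)" using \<open>i - t \<in> S\<close> by blast
  qed
  have "(\<lambda>(t, s). t + s) ` (?K \<times> S) \<subseteq> cube (n + (r + r))"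
  proof clarify
    fix t s i assume *: "s \<in> S" "i \<in> (cube n :: (int^'d) set)" "i - t \<in> S"
    \<comment> \<open>Two points of one tile differ by a difference of two elements of
      \<open>S\<close>, hence by an element of \<open>cube (r + r)\<close>.\<close>
    then have "i + (s - (i - t)) \<in> cube (n + (r + r))"
      using assms(2) by (intro cube_add cube_diff) auto
    then show "t + s \<in> cube (n + (r + r))" by (simp add: algebra_simps)
  qed
  then have "card (?K \<times> S) \<le> card (cube (n + (r + r)) :: (int^'d) set)"
    using inj_on_tiles[OF assms(1), of ?K] finite_cube card_inj_on_le by blast
  then show "card ?K * card S \<le> card (cube (n + (r + r)) :: (int^'d) set)"
    by (simp add: card_cartesian_product)
qed

text \<open>Counterpart from below: every tile meeting \<open>cube n\<close> fits into the enlarged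
  cube, so the tiles that fit already cover \<open>cube n\<close>.\<close>

lemma tiles_inside_cube:
  fixes n :: nat and S T :: "(int^'d) set"
  assumes "tiles S T" "S \<subseteq> cube r"
  obtains K where "finite K" "K \<subseteq> T" "(\<Union>t\<in>K. (+) t ` S) \<subseteq> cube (n + (r + r))"
    "card (cube n :: (int^'d) set) \<le> card K * card S"
proof -
  let ?K = "{t \<in> T. (+) t ` S \<subseteq> cube (n + (r + r))}"
  have finS: "finite S" "S \<noteq> {}" using assms(1) by (auto simp: tiles_def)
  then obtain s where s: "s \<in> S" by blast
  have "?K \<subseteq> (\<lambda>i. i - s) ` cube (n + (r + r))"
  proof
    fix t assume "t \<in> ?K"
    then have "t + s \<in> cube (n + (r + r))" "t = (t + s) - s" using s by auto
    then show "t \<in> (\<lambda>i. i - s) ` cube (n + (r + r))" by blast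
  qed
  then have finK: "finite ?K"
    using finite_cube by (meson finite_imageI finite_subset)
  have "cube n \<subseteq> (\<lambda>(t, s). t + s) ` (?K \<times> S)"
  proof
    fix i assume i: "i \<in> (cube n :: (int^'d) set)"
    obtain t where t: "t \<in> T" "i - t \<in> S" using assms(1) unfolding tiles_def by blast
    have "(+) t ` S \<subseteq> cube (n + (r + r))"
    proof clarify
      fix s assume "s \<in> S"
      then have "i + (s - (i - t)) \<in> cube (n + (r + r))"
        using assms(2) i t by (intro cube_add cube_diff) auto
      then show "t + s \<in> cube (n + (r + r))" by (simp add: algebra_simps)
    qed
    then have "(t, i - t) \<in> ?K \<times> S" "i = (\<lambda>(t, s). t + s) (t, i - t)" using t by auto
    then show "i \<in> (\<lambda>(t, s). t + s) ` (?K \<times> S)" by blast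
  qed
  then have "card (cube n :: (int^'d) set) \<le> card (?K \<times> S)"
    using finK finS by (intro surj_card_le) auto
  then have "card (cube n :: (int^'d) set) \<le> card ?K * card S"
    by (simp add: card_cartesian_product)
  then show ?thesis using that[of ?K] finK by blast
qed

section \<open>Pattern counts and the existence of the entropy limit\<close>

text \<open>These are the properties that pattern counting uses, shared by \<open>X\<close>, by its
  projection to \<open>L\<close> (over \<open>int^1\<close>) and by its full extension. Nonemptiness
  makes all pattern counts positive, so their logarithms behave as expected.\<close>

locale invariant_configurations =
  fixes A :: "'a set" and X :: "(int^'d \<Rightarrow> 'a) set"
  assumes finite_alphabet: "finite A"
    and nonempty: "X \<noteq> {}"
    and in_alphabet: "x \<in> X \<Longrightarrow> x i \<in> A"
    and shift_closed: "x \<in> X \<Longrightarrow> shift i x \<in> X"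
begin

lemma restrictions_subset_PiE: "restrictions F X \<subseteq> PiE F (\<lambda>_. A)"
  unfolding restrictions_def using in_alphabet by auto

lemma finite_restrictions: "finite F \<Longrightarrow> finite (restrictions F X)"
  using restrictions_subset_PiE finite_alphabet by (metis finite_PiE finite_subset)

lemma card_restrictions_pos: "finite F \<Longrightarrow> card (restrictions F X) > 0"
  using finite_restrictions nonempty by (simp add: card_gt_0_iff restrictions_def)

text \<open>A pattern on \<open>F\<close> is determined by what is seen on the covering translates
  of \<open>S\<close>. By shift invariance each of these views is a pattern of \<open>X\<close> on
  \<open>S\<close> itself.\<close>

lemma card_restrictions_cover:
  assumes "finite S" "finite K" "F \<subseteq> (\<Union>t\<in>K. (+) t ` S)"
  shows "card (restrictions F X) \<le> card (restrictions S X) ^ card K"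
proof -
  let ?f = "\<lambda>x. \<lambda>t\<in>K. restrict (shift t x) S"
  have "card ((\<lambda>x. restrict x F) ` X) \<le> card (PiE K (\<lambda>_. restrictions S X))"
  proof (rule card_image_le_card[where f = ?f])
    show "finite (PiE K (\<lambda>_. restrictions S X))"
      using assms finite_restrictions by (intro finite_PiE) auto
    show "?f ` X \<subseteq> PiE K (\<lambda>_. restrictions S X)"
      unfolding restrictions_def using shift_closed by auto
    fix x y assume "?f x = ?f y"
    then have *: "shift t x s = shift t y s" if "t \<in> K" "s \<in> S" for t s
      using that unfolding restrict_eq_iff by blast
    show "restrict x F = restrict y F"
      unfolding restrict_eq_iff
    proof
      fix i assume "i \<in> F"
      then obtain t s where "t \<in> K" "s \<in> S" "i = t + s" using assms(3) by blast
      then show "x i = y i" using * by (simp add: shift_def)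
    qed
  qed
  then show ?thesis
    unfolding restrictions_def by (simp add: card_PiE assms)
qed

text \<open>The terms of the sequence in \<open>h_top\<close>, named because \<open>h_top\<close> is
  a \<open>lim\<close> and says nothing until convergence is proved.\<close>

definition rate :: "nat \<Rightarrow> real" where
  "rate n = ln (real (card (restrictions (cube n) X))) / real (card (cube n :: (int^'d) set))"

lemma rate_nonneg: "0 \<le> rate n"
  unfolding rate_def using card_restrictions_pos[OF finite_cube, of n]
  by (intro divide_nonneg_nonneg ln_ge_zero) auto

text \<open>Covering \<open>cube n\<close> by tiles needs at most
  \<open>card (cube (n + c)) / card S\<close> of them. The margin \<open>c\<close> is twice the
  radius of a cube around \<open>S\<close>, so it does not depend on \<open>n\<close>.\<close>

lemma rate_le_tile:
  assumes "tiles S T"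
  obtains c where "\<And>n. rate n \<le> ln (real (card (restrictions S X))) / real (card S) *
      (real (card (cube (n + c) :: (int^'d) set)) / real (card (cube n :: (int^'d) set)))"
proof -
  have S: "finite S" "S \<noteq> {}" using assms by (auto simp: tiles_def)
  obtain r where r: "S \<subseteq> cube r" using finite_subset_cube S by blast
  let ?N = "real (card (restrictions S X))"
  have "rate n \<le> ln ?N / real (card S) *
      (real (card (cube (n + (r + r)) :: (int^'d) set)) / real (card (cube n :: (int^'d) set)))" for n
  proof -
    obtain K where K: "finite K" "cube n \<subseteq> (\<Union>t\<in>K. (+) t ` S)"
        "card K * card S \<le> card (cube (n + (r + r)) :: (int^'d) set)"
      using tiles_meeting_cube[OF assms r] by metis
    have cS: "card S > 0" using S by (simp add: card_gt_0_iff)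
    have N: "?N \<ge> 1" using card_restrictions_pos[OF S(1)] by simp
    have "real (card (restrictions (cube n) X)) \<le> ?N ^ card K"
      using card_restrictions_cover[OF S(1) K(1,2)] by (metis of_nat_le_iff of_nat_power)
    then have "ln (real (card (restrictions (cube n) X))) \<le> real (card K) * ln ?N"
      using card_restrictions_pos[OF finite_cube, of n] N
      by (metis (no_types, lifting) ln_mono ln_realpow of_nat_0_less_iff zero_less_one less_le_trans)
    also have "real (card K) \<le> real (card (cube (n + (r + r)) :: (int^'d) set)) / real (card S)"
      using K(3) cS by (simp add: pos_le_divide_eq flip: of_nat_mult)
    then have "real (card K) * ln ?N \<le> real (card (cube (n + (r + r)) :: (int^'d) set)) / real (card S) * ln ?N"
      using N by (intro mult_right_mono) auto
    finally have "rate n \<le> real (card (cube (n + (r + r)) :: (int^'d) set)) / real (card S) * ln ?N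
        / real (card (cube n :: (int^'d) set))"
      unfolding rate_def by (intro divide_right_mono) auto
    then show ?thesis by (simp add: field_simps)
  qed
  then show ?thesis using that by blast
qed

text \<open>A Fekete argument: tiling by \<open>cube m\<close> bounds the upper limit of the rates
  by \<open>rate m\<close> for every \<open>m\<close>, so the rates converge to their
  infimum.\<close>

lemma rate_tendsto: "rate \<longlonglongrightarrow> h_top X"
proof -
  have bdd: "bdd_below (range rate)" using rate_nonneg by (intro bdd_belowI[of _ 0]) auto
  define h where "h = Inf (range rate)"
  have h: "h \<le> rate n" for n unfolding h_def using bdd by (intro cInf_lower) auto
  have "rate \<longlonglongrightarrow> h"
  proof (rule order_tendstoI)
    show "\<forall>\<^sub>F n in sequentially. a < rate n" if "a < h" for a
      using h that by (intro always_eventually) (metis less_le_trans)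
    fix a assume "h < a"
    then obtain m where m: "rate m < a"
      unfolding h_def using bdd by (auto simp: cInf_less_iff)
    \<comment> \<open>For the tile \<open>cube m\<close> the quotient in \<open>rate_le_tile\<close>
      is \<open>rate m\<close> itself.\<close>
    obtain T :: "(int^'d) set" where T: "tiles (cube m) T" using tiles_cube by blast
    obtain c where c: "rate n \<le> rate m * (real (card (cube (n + c) :: (int^'d) set)) /
        real (card (cube n :: (int^'d) set)))" for n
      using rate_le_tile[OF T] unfolding rate_def by blast
    have "(\<lambda>n. rate m * (real (card (cube (n + c) :: (int^'d) set)) /
        real (card (cube n :: (int^'d) set)))) \<longlonglongrightarrow> rate m * 1"
      by (intro tendsto_mult tendsto_const card_cube_ratio_tendsto)
    then have "\<forall>\<^sub>F n in sequentially. rate m * (real (card (cube (n + c) :: (int^'d) set)) /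
        real (card (cube n :: (int^'d) set))) < a"
      using m by (intro order_tendstoD(2)) auto
    then show "\<forall>\<^sub>F n in sequentially. rate n < a"
      by eventually_elim (use c le_less_trans in blast)
  qed
  moreover have "h_top X = lim rate" unfolding h_top_def rate_def[abs_def] ..
  ultimately show ?thesis by (simp add: limI)
qed

lemma h_top_le_tile:
  assumes "tiles S T"
  shows "h_top X \<le> ln (real (card (restrictions S X))) / real (card S)"
proof -
  let ?q = "ln (real (card (restrictions S X))) / real (card S)"
  obtain c where c: "rate n \<le> ?q *
      (real (card (cube (n + c) :: (int^'d) set)) / real (card (cube n :: (int^'d) set)))" for n
    using rate_le_tile[OF assms] by blast
  have "(\<lambda>n. ?q * (real (card (cube (n + c) :: (int^'d) set)) /
      real (card (cube n :: (int^'d) set)))) \<longlonglongrightarrow> ?q * 1"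
    by (intro tendsto_mult tendsto_const card_cube_ratio_tendsto)
  then have "h_top X \<le> ?q * 1"
    using rate_tendsto c by (intro LIMSEQ_le) auto
  then show ?thesis by simp
qed

end

section \<open>Splitting the lattice into a line and a complement\<close>

text \<open>Here \<open>c\<close> and \<open>p\<close> are the projections of the decomposition of \<open>\<int>\<^sup>d\<close> as \<open>L \<oplus> L'\<close>.\<close>

locale lattice_splitting =
  fixes u :: "int^'d" and L L' :: "(int^'d) set"
    and c :: "int^'d \<Rightarrow> int" and p :: "int^'d \<Rightarrow> int^'d"
  assumes L_eq: "L = range (\<lambda>j. j *s u)"
    and decomp: "c i *s u + p i = i"
    and p_in: "p i \<in> L'"
    and c_line: "w \<in> L' \<Longrightarrow> c (j *s u + w) = j"
    and p_line: "w \<in> L' \<Longrightarrow> p (j *s u + w) = w"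
    and zero_in: "0 \<in> L'"
    and add_closed: "v \<in> L' \<Longrightarrow> w \<in> L' \<Longrightarrow> v + w \<in> L'"
begin

lemma c_add: "c (i + j *s u) = c i + j"
proof -
  have "i + j *s u = (c i + j) *s u + p i"
    using decomp[of i] by (simp add: int_vec.scale_left_distrib algebra_simps)
  then show ?thesis by (simp only: c_line[OF p_in])
qed

lemma c_diff: "c (i - j *s u) = c i - j"
  using c_add[of i "- j"] by simp

lemma c_multiple: "c (j *s u) = j"
  using c_line[OF zero_in, of j] by simp

lemma inj_multiple: "inj_on (\<lambda>j. j *s u) J"
  by (metis c_multiple inj_onI)

lemma u_nonzero: "u \<noteq> 0"
  using c_multiple[of 1] c_multiple[of 0] by auto

text \<open>Only the coordinate \<open>c\<close> along \<open>u\<close> matters: the translation set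
  contains all of \<open>L'\<close> and, along \<open>u\<close>, the multiples of the length. Thus a
  one-dimensional set tiles the whole lattice, which links \<open>h_top X\<close> to patterns on
  \<open>L\<close>.\<close>

lemma tiles_segment:
  assumes "a \<le> b"
  shows "tiles ((\<lambda>j. j *s u) ` {a..b}) {t. (b - a + 1) dvd c t}"
  unfolding tiles_def
proof (intro conjI allI)
  fix i
  obtain s where s: "(b - a + 1) dvd s" "c i - s \<in> {a..b}"
    using interval_ex1_multiple[OF assms] by blast
  show "\<exists>!t. t \<in> {t. (b - a + 1) dvd c t} \<and> i - t \<in> (\<lambda>j. j *s u) ` {a..b}"
  proof (rule ex1I)
    have "c (i - (c i - s) *s u) = s"
      unfolding c_diff by simp
    moreover have "i - (i - (c i - s) *s u) = (c i - s) *s u"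
      by (simp only: diff_diff_eq2 add_diff_cancel_left')
    ultimately show "i - (c i - s) *s u \<in> {t. (b - a + 1) dvd c t} \<and>
        i - (i - (c i - s) *s u) \<in> (\<lambda>j. j *s u) ` {a..b}"
      using s by (metis imageI mem_Collect_eq)
    fix t assume t: "t \<in> {t. (b - a + 1) dvd c t} \<and> i - t \<in> (\<lambda>j. j *s u) ` {a..b}"
    then obtain j where j: "j \<in> {a..b}" "i - t = j *s u" by blast
    then have t_eq: "t = i + (- j) *s u" by (simp add: algebra_simps)
    then have "c t = c i - j" using c_add[of i "- j"] by simp
    then have "c t = s"
      using t j s interval_ex1_multiple[OF assms, of "c i"] by auto
    then show "t = i - (c i - s) *s u"
      using t_eq \<open>c t = c i - j\<close> by simp
  qed
qed (use assms in auto)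

end

text \<open>Spanning provides a coefficient at \<open>u\<close> for every point, and independence
  over the integers makes it unique. The remainder then lies in the span of \<open>V\<close> and
  serves as \<open>p\<close>.\<close>

lemma complementary_sublattices_splitting:
  assumes "complementary_sublattices u L L'"
  obtains c p where "lattice_splitting u L L' c p"
proof -
  obtain V where V: "finite V" "u \<notin> V" "int_vec.independent (insert u V)"
      "int_vec.span (insert u V) = UNIV" "L = int_vec.span {u}" "L' = int_vec.span V"
    using assms unfolding complementary_sublattices_def by blast
  have not_in: "j = 0" if span: "j *s u \<in> int_vec.span V" for j
  proof (rule ccontr)
    assume "j \<noteq> 0"
    obtain f where f: "j *s u = (\<Sum>v\<in>V. f v *s v)"
      using span unfolding int_vec.span_finite[OF V(1)] by blast
    \<comment> \<open>Giving \<open>u\<close> the coefficient \<open>- j\<close> leaves the sum over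
      \<open>V\<close> unchanged, as \<open>u\<close> is not in \<open>V\<close>, and produces a
      nontrivial relation.\<close>
    have "(\<Sum>v\<in>V. (f(u := - j)) v *s v) = (\<Sum>v\<in>V. f v *s v)"
      using V(2) by (intro sum.cong) auto
    then have "(\<Sum>v\<in>insert u V. (f(u := - j)) v *s v) = 0"
      using V(1,2) f by simp
    then have "int_vec.dependent (insert u V)"
      using V(1) \<open>j \<noteq> 0\<close> unfolding int_vec.dependent_finite[OF finite.insertI[OF V(1)]]
      by (intro exI[of _ "f(u := - j)"]) auto
    then show False using V(3) by blast
  qed
  have "\<forall>i. \<exists>k. i - k *s u \<in> int_vec.span V"
    using V(4) by (metis UNIV_I int_vec.span_breakdown_eq)
  then obtain c where c: "\<And>i. i - c i *s u \<in> int_vec.span V" by metis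
  have c_line: "c (j *s u + w) = j" if w: "w \<in> L'" for j w
  proof -
    have "(j *s u + w) - c (j *s u + w) *s u - w \<in> int_vec.span V"
      using c w V(6) int_vec.span_diff by blast
    then have "(j - c (j *s u + w)) *s u \<in> int_vec.span V"
      by (simp add: int_vec.scale_left_diff_distrib algebra_simps)
    then show ?thesis using not_in by fastforce
  qed
  have "lattice_splitting u L L' c (\<lambda>i. i - c i *s u)"
  proof
    show "L = range (\<lambda>j. j *s u)" using V(5) by (simp add: int_vec.span_singleton)
  qed (use c c_line V(6) in \<open>auto simp: int_vec.span_zero int_vec.span_add\<close>)
  then show ?thesis using that by blast
qed

section \<open>Projectional entropy compared with topological entropy\<close>

text \<open>Only points of \<open>L\<close> are read, so the value that \<open>restrict\<close>
  assigns outside \<open>L\<close> never appears.\<close>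

lemma as_Z_shift_restrictions:
  assumes "range (\<lambda>j. j *s u) \<subseteq> L"
  shows "as_Z_shift u (restrictions L X) = (\<lambda>x j. x ((j $ 1) *s u)) ` X"
  using assms unfolding as_Z_shift_def restrictions_def image_image
  by (intro image_cong refl ext) auto

locale shift_along_lattice = invariant_configurations A X + lattice_splitting u L L' c p
  for A :: "'a set" and X :: "(int^'d \<Rightarrow> 'a) set"
    and u :: "int^'d" and L L' :: "(int^'d) set" and c p
begin

abbreviation "X_L \<equiv> as_Z_shift u (restrictions L X)"

lemma X_L_eq: "X_L = (\<lambda>x j. x ((j $ 1) *s u)) ` X"
  using L_eq by (intro as_Z_shift_restrictions) simp

lemma invariant_X_L: "invariant_configurations A X_L"
proof
  fix y :: "int^1 \<Rightarrow> 'a" and i assume "y \<in> X_L"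
  then obtain x where x: "x \<in> X" "y = (\<lambda>j. x ((j $ 1) *s u))" unfolding X_L_eq by blast
  show "y i \<in> A" using x in_alphabet by simp
  have "shift i y = (\<lambda>j. shift ((i $ 1) *s u) x ((j $ 1) *s u))"
    using x(2) by (simp add: shift_def int_vec.scale_left_distrib)
  then show "shift i y \<in> X_L" unfolding X_L_eq using shift_closed x(1) by blast
qed (use nonempty finite_alphabet X_L_eq in auto)

text \<open>Both sides count elements of \<open>X\<close> up to agreement on the same points of
  \<open>L\<close>. The entropy of the projection can therefore be computed from segments inside
  \<open>X\<close>.\<close>

lemma card_restrictions_X_L:
  "card (restrictions (block a b) X_L) = card (restrictions ((\<lambda>j. j *s u) ` {a $ 1..b $ 1}) X)"
proof -
  have "restrictions (block a b) X_L = (\<lambda>x. restrict (\<lambda>j. x ((j $ 1) *s u)) (block a b)) ` X"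
    unfolding X_L_eq restrictions_def[of "block a b"] image_image ..
  also have "card \<dots> = card ((\<lambda>x. restrict x ((\<lambda>j. j *s u) ` {a $ 1..b $ 1})) ` X)"
  proof (rule card_image_eq_card_image, unfold restrict_eq_iff)
    fix x y :: "int^'d \<Rightarrow> 'a"
    have "block a b = (\<lambda>j. vec j) ` {a $ 1..b $ 1}"
      by (auto simp: block_def forall_1 vec_eq_iff image_iff intro!: bexI)
    then show "(\<forall>i\<in>block a b. x ((i $ 1) *s u) = y ((i $ 1) *s u)) \<longleftrightarrow>
        (\<forall>i\<in>(\<lambda>j. j *s u) ` {a $ 1..b $ 1}. x i = y i)"
      by simp
  qed
  finally show ?thesis unfolding restrictions_def .
qed

text \<open>With a centred segment of \<open>L\<close> as tile, the tile bound is exactly the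
  \<open>m\<close>-th rate of the projection. Then \<open>m\<close> tends to infinity.\<close>

lemma h_top_le_proj_entropy: "h_top X \<le> proj_entropy u L X"
proof -
  interpret X_L: invariant_configurations A X_L by (rule invariant_X_L)
  have "h_top X \<le> X_L.rate m" for m
  proof -
    have "h_top X \<le> ln (real (card (restrictions ((\<lambda>j. j *s u) ` {- int m..int m}) X)))
        / real (card ((\<lambda>j. j *s u) ` {- int m..int m}))"
      by (intro h_top_le_tile[OF tiles_segment]) simp
    also have "\<dots> = X_L.rate m"
      unfolding X_L.rate_def
      by (simp add: cube_eq_block card_restrictions_X_L card_block card_image inj_multiple)
    finally show ?thesis .
  qed
  then show ?thesis
    unfolding proj_entropy_def using X_L.rate_tendsto LIMSEQ_le_const by blast
qed

text \<open>The tile bound in dimension one, for an interval in any position, because a cube meets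
  the translates of \<open>L\<close> in segments that need not be centred.\<close>

lemma proj_entropy_le_segment:
  assumes "a \<le> b"
  shows "proj_entropy u L X * real_of_int (b - a + 1)
    \<le> ln (real (card (restrictions ((\<lambda>j. j *s u) ` {a..b}) X)))"
proof -
  interpret X_L: invariant_configurations A X_L by (rule invariant_X_L)
  have "tiles (block (vec a) (vec b) :: (int^1) set)
      {t. \<forall>k. ((vec b :: int^1) $ k - (vec a :: int^1) $ k + 1) dvd t $ k}"
    using assms by (intro tiles_block) simp
  from X_L.h_top_le_tile[OF this] assms show ?thesis
    by (simp add: proj_entropy_def card_restrictions_X_L card_block pos_le_divide_eq)
qed

lemma full_extension_iff:
  "x \<in> full_extension A L L' (restrictions L X) \<longleftrightarrow>
    range x \<subseteq> A \<and> (\<forall>w\<in>L'. \<exists>z\<in>X. \<forall>j. x (j *s u + w) = z (j *s u))"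
  unfolding full_extension_def restrictions_def L_eq by (auto simp: image_iff restrict_eq_iff)

text \<open>Cubes are convex: each coordinate of \<open>j *s u + w\<close> is monotone in
  \<open>j\<close>, so it stays in range between the extreme parameters.\<close>

lemma segment_eq_cube_line:
  fixes n :: nat and w :: "int^'d"
  defines "I \<equiv> {j. j *s u + w \<in> cube n}"
  assumes "I \<noteq> {}"
  obtains a b where "a \<le> b" "I = {a..b}"
proof -
  have "I \<subseteq> (\<lambda>i. c i - c w) ` cube n"
  proof
    fix j assume "j \<in> I"
    then have "j *s u + w \<in> cube n" unfolding I_def by blast
    \<comment> \<open>The projection \<open>c\<close> recovers the parameter from the point, so
      finiteness of the cube passes to \<open>I\<close>.\<close>
    moreover have "j = c (j *s u + w) - c w" using c_add[of w j] by (simp add: add.commute)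
    ultimately show "j \<in> (\<lambda>i. c i - c w) ` cube n" by (rule rev_image_eqI)
  qed
  then have fin: "finite I" using finite_cube by (meson finite_imageI finite_subset)
  have "j \<in> I" if "Min I \<le> j" "j \<le> Max I" for j
  proof -
    have "\<bar>j * u $ k + w $ k\<bar> \<le> int n" for k
    proof -
      have "Min I \<in> I" "Max I \<in> I" using fin assms(2) by simp_all
      then have "\<bar>Min I * u $ k + w $ k\<bar> \<le> int n" "\<bar>Max I * u $ k + w $ k\<bar> \<le> int n"
        unfolding I_def by (simp_all add: mem_cube)
      moreover have "Min I * u $ k \<le> j * u $ k \<and> j * u $ k \<le> Max I * u $ k \<or>
          Max I * u $ k \<le> j * u $ k \<and> j * u $ k \<le> Min I * u $ k"
        using that by (cases "u $ k \<ge> 0") (auto intro: mult_right_mono mult_right_mono_neg)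
      ultimately show ?thesis by linarith
    qed
    then show ?thesis unfolding I_def by (simp add: mem_cube)
  qed
  then have "{Min I..Max I} \<subseteq> I" by (meson atLeastAtMost_iff subsetI)
  moreover have "I \<subseteq> {Min I..Max I}" using fin by (meson Max_ge Min_le atLeastAtMost_iff subsetI)
  ultimately have "I = {Min I..Max I}" by (rule subset_antisym[rotated])
  moreover have "Min I \<le> Max I" using fin assms(2) by simp
  ultimately show ?thesis using that by blast
qed

text \<open>In the full extension the lines carry independent patterns, so the count on a cube is at
  least the product of the counts on its segments, whose lengths add up to the volume of the
  cube.\<close>

lemma proj_entropy_le_h_top:
  assumes ext: "X = full_extension A L L' (restrictions L X)"
  shows "proj_entropy u L X \<le> h_top X"
proof -
  let ?h = "proj_entropy u L X"
  have "?h \<le> rate n" for n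
  proof -
    let ?C = "cube n :: (int^'d) set"
    \<comment> \<open>\<open>W\<close> indexes the lines parallel to \<open>L\<close> that meet the
      cube, and \<open>I w\<close> holds the parameters at which line \<open>w\<close> is
      inside.\<close>
    define W where "W = p ` ?C"
    define I where "I w = {j. j *s u + w \<in> ?C}" for w
    have finW: "finite W" unfolding W_def using finite_cube by blast
    have WL: "W \<subseteq> L'" unfolding W_def using p_in by blast
    have I: "\<exists>a b. a \<le> b \<and> I w = {a..b}" if w: "w \<in> W" for w
    proof -
      obtain i where "i \<in> ?C" "w = p i" using w unfolding W_def by blast
      then have "c i \<in> {j. j *s u + w \<in> ?C}" using decomp by simp
      then have ne: "{j. j *s u + w \<in> ?C} \<noteq> {}" by blast
      obtain a b where "a \<le> b" "{j. j *s u + w \<in> ?C} = {a..b}"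
        by (rule segment_eq_cube_line[OF ne])
      then show ?thesis unfolding I_def by blast
    qed
    define B where "B w = (\<lambda>j. j *s u) ` I w" for w
    have finB: "finite (B w)" if "w \<in> W" for w using I[OF that] unfolding B_def by auto
    have card_C: "card ?C = (\<Sum>w\<in>W. card (I w))"
    proof -
      have "bij_betw (\<lambda>i. (p i, c i)) ?C (SIGMA w:W. I w)"
        by (rule bij_betw_byWitness[where f' = "\<lambda>(w, j). j *s u + w"])
          (use decomp WL c_line p_line in \<open>auto simp: W_def I_def\<close>)
      then have "card ?C = card (SIGMA w:W. I w)" by (rule bij_betw_same_card)
      also have "\<dots> = (\<Sum>w\<in>W. card (I w))"
        using finW I by (subst card_SigmaI) (auto, metis finite_atLeastAtMost_int)
      finally show ?thesis .
    qed
    have "?h * real (card ?C) = (\<Sum>w\<in>W. ?h * real (card (I w)))"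
      by (simp add: card_C sum_distrib_left)
    also have "\<dots> \<le> (\<Sum>w\<in>W. ln (real (card (restrictions (B w) X))))"
    proof (rule sum_mono)
      fix w assume "w \<in> W"
      then obtain a b where "a \<le> b" "I w = {a..b}" using I by blast
      then show "?h * real (card (I w)) \<le> ln (real (card (restrictions (B w) X)))"
        using proj_entropy_le_segment[of a b] unfolding B_def by simp
    qed
    also have "\<dots> = ln (\<Prod>w\<in>W. real (card (restrictions (B w) X)))"
      using finB card_restrictions_pos finW by (subst ln_prod) auto
    also have "\<dots> = ln (real (card (PiE W (\<lambda>w. restrictions (B w) X))))"
      using finW by (simp add: card_PiE)
    also have "\<dots> \<le> ln (real (card (restrictions ?C X)))"
    proof -
      have sub: "PiE W (\<lambda>w. restrictions (B w) X)
          \<subseteq> (\<lambda>q. \<lambda>w\<in>W. \<lambda>t\<in>B w. q (t + w)) ` restrictions ?C X"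
      proof
        fix P assume P: "P \<in> PiE W (\<lambda>w. restrictions (B w) X)"
        then have "\<forall>w\<in>W. \<exists>x\<in>X. P w = restrict x (B w)"
          unfolding restrictions_def by blast
        then obtain x where x: "\<And>w. w \<in> W \<Longrightarrow> x w \<in> X" "\<And>w. w \<in> W \<Longrightarrow> P w = restrict (x w) (B w)"
          by metis
        obtain x0 where x0: "x0 \<in> X" using nonempty by blast
        \<comment> \<open>The chosen configurations are placed on their lines, and \<open>x0\<close>
          fills the lines that miss the cube.\<close>
        define y where "y i = (if p i \<in> W then x (p i) else x0) (c i *s u)" for i
        have "y \<in> full_extension A L L' (restrictions L X)"
          unfolding full_extension_iff
        proof (intro conjI ballI)
          show "range y \<subseteq> A" unfolding y_def using x(1) x0 in_alphabet by auto
          fix w assume "w \<in> L'"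
          then have "\<forall>j. y (j *s u + w) = (if w \<in> W then x w else x0) (j *s u)"
            unfolding y_def by (simp add: c_line p_line)
          then show "\<exists>z\<in>X. \<forall>j. y (j *s u + w) = z (j *s u)"
            using x(1) x0 by (intro bexI[of _ "if w \<in> W then x w else x0"]) auto
        qed
        then have "y \<in> X" unfolding ext[symmetric] .
        moreover have "P = (\<lambda>w\<in>W. \<lambda>t\<in>B w. restrict y ?C (t + w))"
        proof (rule extensionalityI[where A = W])
          show "P \<in> extensional W" using P by (simp add: PiE_def)
          fix w assume w: "w \<in> W"
          then have "w \<in> L'" using WL by blast
          then have *: "x w (j *s u) = y (j *s u + w) \<and> j *s u + w \<in> ?C" if "j \<in> I w" for j
            using that w by (simp add: y_def I_def c_line p_line)
          have "restrict (x w) (B w) = (\<lambda>t\<in>B w. restrict y ?C (t + w))"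
            unfolding restrict_eq_iff B_def using * by simp
          then show "P w = (\<lambda>w\<in>W. \<lambda>t\<in>B w. restrict y ?C (t + w)) w"
            using w x(2) by simp
        qed simp
        ultimately show "P \<in> (\<lambda>q. \<lambda>w\<in>W. \<lambda>t\<in>B w. q (t + w)) ` restrictions ?C X"
          unfolding restrictions_def image_image by - (rule rev_image_eqI)
      qed
      have "finite (restrictions ?C X)" by (intro finite_restrictions finite_cube)
      then have "card (PiE W (\<lambda>w. restrictions (B w) X)) \<le> card (restrictions ?C X)"
        by (rule surj_card_le[OF _ sub])
      moreover have "card (PiE W (\<lambda>w. restrictions (B w) X)) > 0"
        using finW finB card_restrictions_pos by (subst card_PiE) (simp_all add: prod_pos)
      ultimately show ?thesis by (intro ln_mono) simp_all
    qed
    finally show ?thesis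
      unfolding rate_def using card_cube_pos[where 'a = 'd, of n] by (simp add: pos_le_divide_eq)
  qed
  then show ?thesis by (intro LIMSEQ_le_const[OF rate_tendsto]) blast
qed

end

section \<open>Strict drop of entropy when a replaceable pattern is forbidden\<close>

context invariant_configurations
begin

text \<open>Forbidding the pattern \<open>x0\<close> at one more tile \<open>t\<close> loses a fixed
  fraction. Planting it there turns patterns in \<open>?Q\<close> into patterns in
  \<open>?Q - ?Q'\<close>, and at most \<open>?c\<close> of them are merged, so
  \<open>card ?Q\<close> is at most \<open>?c\<close> times the number lost.\<close>

lemma card_avoiding_le:
  fixes N M n :: nat and K :: "(int^'d) set" and x0 :: "int^'d \<Rightarrow> 'a"
  defines "avoiding \<equiv> \<lambda>K. {x \<in> X. \<forall>t\<in>K. \<exists>i\<in>cube N. x (t + i) \<noteq> x0 i}"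
  assumes replace: "\<And>x t. x \<in> X \<Longrightarrow>
      \<exists>y\<in>X. (\<forall>i\<in>cube N. y (t + i) = x0 i) \<and> (\<forall>i\<in>cube n. i - t \<notin> cube M \<longrightarrow> y i = x i)"
    and tiles: "tiles (cube M) T" and "N \<le> M"
    and K: "finite K" "K \<subseteq> T" "(\<Union>t\<in>K. (+) t ` cube M) \<subseteq> cube n"
  shows "real (card (restrictions (cube n) (avoiding K)))
    \<le> exp (- real (card K) / real (card A ^ card (cube M :: (int^'d) set)))
       * real (card (restrictions (cube n) X))"
  using K
proof (induction K rule: finite_induct)
  case empty
  then show ?case by (simp add: avoiding_def)
next
  case (insert t K)
  let ?C = "cube n :: (int^'d) set" and ?B = "cube M :: (int^'d) set"
  let ?c = "card A ^ card ?B"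
  let ?Q = "restrictions ?C (avoiding K)" and ?Q' = "restrictions ?C (avoiding (insert t K))"
  have A_ne: "A \<noteq> {}" using nonempty in_alphabet by fastforce
  then have c_pos: "?c > 0" using finite_alphabet by (simp add: card_gt_0_iff)
  have tC: "(+) t ` ?B \<subseteq> ?C" using insert.prems by blast
  have NM: "cube N \<subseteq> ?B" using \<open>N \<le> M\<close> by (rule cube_mono)
  have sub: "avoiding K \<subseteq> X" "avoiding (insert t K) \<subseteq> avoiding K" unfolding avoiding_def by auto
  have finQ: "finite ?Q"
    using finite_restrictions[OF finite_cube] restrictions_mono[OF sub(1)] by (rule finite_subset[rotated])
  have Q'Q: "?Q' \<subseteq> ?Q" using sub(2) by (rule restrictions_mono)
  define R where "R x y \<longleftrightarrow> y \<in> X \<and> (\<forall>i\<in>cube N. y (t + i) = x0 i) \<and>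
      (\<forall>i\<in>?C. i - t \<notin> ?B \<longrightarrow> y i = x i)" for x y
  have "\<forall>x\<in>X. \<exists>y. R x y" unfolding R_def using replace by blast
  then obtain f where f: "\<And>x. x \<in> X \<Longrightarrow> R x (f x)" by metis
  have f_in: "restrict (f x) ?C \<in> ?Q - ?Q'" if "x \<in> avoiding K" for x
  proof
    have R: "R x (f x)" using f that sub by blast
    have "f x \<in> avoiding K"
      unfolding avoiding_def
    proof (intro CollectI conjI ballI)
      show "f x \<in> X" using R unfolding R_def by blast
      fix s assume s: "s \<in> K"
      then obtain i where i: "i \<in> cube N" "x (s + i) \<noteq> x0 i"
        using \<open>x \<in> avoiding K\<close> unfolding avoiding_def by blast
      have iB: "i \<in> ?B" using i NM by blast
      then have "s + i \<in> ?C" using s insert.prems by blast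
      \<comment> \<open>Tiles are disjoint, so planting at \<open>t\<close> leaves tile
        \<open>s\<close> unchanged and the pattern stays avoided there.\<close>
      moreover have "s + i - t \<notin> ?B"
      proof
        assume "s + i - t \<in> ?B"
        moreover have "s \<in> T" "t \<in> T" using s insert.prems by auto
        moreover have "s + i - s \<in> ?B" using iB by simp
        moreover have "\<exists>!t. t \<in> T \<and> (s + i) - t \<in> ?B" using tiles unfolding tiles_def by blast
        ultimately have "s = t" by blast
        then show False using s insert.hyps by blast
      qed
      ultimately have "f x (s + i) = x (s + i)" using R unfolding R_def by blast
      then show "\<exists>i\<in>cube N. f x (s + i) \<noteq> x0 i" using i by metis
    qed
    then show "restrict (f x) ?C \<in> ?Q" by (rule restrictionsI)
    show "restrict (f x) ?C \<notin> ?Q'"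
    proof
      assume "restrict (f x) ?C \<in> ?Q'"
      then obtain y where y: "y \<in> avoiding (insert t K)" "restrict (f x) ?C = restrict y ?C"
        by (rule restrictionsE)
      then obtain i where i: "i \<in> cube N" "y (t + i) \<noteq> x0 i" unfolding avoiding_def by blast
      then have "t + i \<in> ?C" using NM tC by blast
      then have "y (t + i) = f x (t + i)" using y(2) unfolding restrict_eq_iff by metis
      then show False using R i unfolding R_def by metis
    qed
  qed
  \<comment> \<open>Outside \<open>t + ?B\<close> nothing changes, so \<open>x\<close> is recovered from \<open>f x\<close> and its values there.\<close>
  have "card ?Q \<le> card ((?Q - ?Q') \<times> PiE ?B (\<lambda>_. A))"
  proof -
    have "card ((\<lambda>x. restrict x ?C) ` avoiding K) \<le> card ((?Q - ?Q') \<times> PiE ?B (\<lambda>_. A))"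
    proof (rule card_image_le_card[where f = "\<lambda>x. (restrict (f x) ?C, restrict (shift t x) ?B)"])
      show "finite ((?Q - ?Q') \<times> PiE ?B (\<lambda>_. A))"
        using finQ finite_cube finite_alphabet by (intro finite_SigmaI finite_PiE) auto
      show "(\<lambda>x. (restrict (f x) ?C, restrict (shift t x) ?B)) ` avoiding K
          \<subseteq> (?Q - ?Q') \<times> PiE ?B (\<lambda>_. A)"
      proof (rule image_subsetI)
        fix x assume x: "x \<in> avoiding K"
        then have "\<forall>i. x i \<in> A" using sub in_alphabet by blast
        then have "restrict (shift t x) ?B \<in> PiE ?B (\<lambda>_. A)" by (simp add: shift_def)
        then show "(restrict (f x) ?C, restrict (shift t x) ?B) \<in> (?Q - ?Q') \<times> PiE ?B (\<lambda>_. A)"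
          using f_in[OF x] by (rule SigmaI[rotated])
      qed
      fix x y assume xy: "x \<in> avoiding K" "y \<in> avoiding K"
        "(restrict (f x) ?C, restrict (shift t x) ?B) = (restrict (f y) ?C, restrict (shift t y) ?B)"
      then have 1: "\<forall>i\<in>?C. f x i = f y i" and 2: "\<forall>i\<in>?B. x (t + i) = y (t + i)"
        unfolding prod.inject restrict_eq_iff shift_def by blast+
      have R: "R x (f x)" "R y (f y)" using f xy sub by blast+
      have "x i = y i" if "i \<in> ?C" for i
      proof (cases "i - t \<in> ?B")
        case True
        then have "x (t + (i - t)) = y (t + (i - t))" using 2 by blast
        then show ?thesis by simp
      next
        case False
        then have "f x i = x i" "f y i = y i" using R \<open>i \<in> ?C\<close> unfolding R_def by blast+
        then show ?thesis using 1 \<open>i \<in> ?C\<close> by metis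
      qed
      then show "restrict x ?C = restrict y ?C" unfolding restrict_eq_iff by blast
    qed
    then show ?thesis unfolding restrictions_def .
  qed
  also have "\<dots> = (card ?Q - card ?Q') * ?c"
    using Q'Q finQ by (simp add: card_cartesian_product card_PiE finite_cube card_Diff_subset finite_subset)
  finally have "real (card ?Q) \<le> (real (card ?Q) - real (card ?Q')) * real ?c"
    using card_mono[OF finQ Q'Q] by (metis of_nat_diff of_nat_le_iff of_nat_mult)
  then have "real (card ?Q) / real ?c \<le> real (card ?Q) - real (card ?Q')"
    using c_pos by (subst pos_divide_le_eq) auto
  \<comment> \<open>The factor is written as \<open>1 + z\<close> with
    \<open>z = - 1 / real ?c\<close>, ready for the bound \<open>1 + z \<le> exp z\<close>.\<close>
  then have "real (card ?Q') \<le> (1 + - 1 / real ?c) * real (card ?Q)"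
    by (simp add: algebra_simps)
  also have "\<dots> \<le> exp (- 1 / real ?c) * real (card ?Q)"
    by (intro mult_right_mono exp_ge_add_one_self) simp
  also have "\<dots> \<le> exp (- 1 / real ?c) * (exp (- real (card K) / real ?c) * real (card (restrictions ?C X)))"
    using insert.prems by (intro mult_left_mono insert.IH) auto
  also have "\<dots> = exp (- 1 / real ?c + - real (card K) / real ?c) * real (card (restrictions ?C X))"
    unfolding exp_add by (rule mult.assoc[symmetric])
  also have "- 1 / real ?c + - real (card K) / real ?c = - real (card (insert t K)) / real ?c"
    using insert.hyps by (simp add: diff_divide_distrib add_divide_distrib)
  finally show ?case .
qed

text \<open>Shift invariance makes \<open>W\<close> avoid the pattern at every tile. The number of
  tiles in a cube is proportional to its volume, so the losses accumulate to an exponential factor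
  and to a definite loss of entropy.\<close>

lemma h_top_less:
  fixes W :: "(int^'d \<Rightarrow> 'a) set" and N M :: nat and x0 :: "int^'d \<Rightarrow> 'a"
  assumes W: "invariant_configurations A W" "W \<subseteq> X"
    and avoids: "\<And>x. x \<in> W \<Longrightarrow> \<exists>i\<in>cube N. x i \<noteq> x0 i"
    and replace: "\<And>x t n. x \<in> X \<Longrightarrow>
      \<exists>y\<in>X. (\<forall>i\<in>cube N. y (t + i) = x0 i) \<and> (\<forall>i\<in>cube n. i - t \<notin> cube M \<longrightarrow> y i = x i)"
    and "N \<le> M"
  shows "h_top W < h_top X"
proof -
  interpret W: invariant_configurations A W by (rule W(1))
  obtain T :: "(int^'d) set" where T: "tiles (cube M) T" using tiles_cube by blast
  let ?cc = "\<lambda>n. real (card (cube n :: (int^'d) set))"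
  \<comment> \<open>The loss per site: each tile contributes
    \<open>1 / card A ^ card (cube M)\<close> and occupies \<open>card (cube M)\<close>
    sites.\<close>
  define a where "a = 1 / (real (card A ^ card (cube M :: (int^'d) set)) * ?cc M)"
  have A_ne: "A \<noteq> {}" using nonempty in_alphabet by fastforce
  then have cA: "real (card A ^ card (cube M :: (int^'d) set)) > 0"
    using finite_alphabet by (simp add: card_gt_0_iff)
  have cc_pos: "?cc n > 0" for n using card_cube_pos by simp
  have a_pos: "a > 0" unfolding a_def using cA cc_pos by simp
  have le: "W.rate (n + (M + M)) \<le> rate (n + (M + M)) - a * (?cc n / ?cc (n + (M + M)))" for n
  proof -
    let ?n = "n + (M + M)"
    obtain K where K: "finite K" "K \<subseteq> T" "(\<Union>t\<in>K. (+) t ` cube M) \<subseteq> cube ?n"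
        "card (cube n :: (int^'d) set) \<le> card K * card (cube M :: (int^'d) set)"
      using tiles_inside_cube[OF T order_refl] by metis
    let ?Y = "{x \<in> X. \<forall>t\<in>K. \<exists>i\<in>cube N. x (t + i) \<noteq> x0 i}"
    have "W \<subseteq> ?Y"
    proof
      fix x assume x: "x \<in> W"
      have "\<exists>i\<in>cube N. x (t + i) \<noteq> x0 i" for t
        using avoids[OF W.shift_closed[OF x, of t]] by (simp add: shift_def)
      then show "x \<in> ?Y" using x W(2) by blast
    qed
    then have "restrictions (cube ?n) W \<subseteq> restrictions (cube ?n) ?Y"
      by (rule restrictions_mono)
    moreover have "finite (restrictions (cube ?n) ?Y)"
      by (rule finite_subset[OF restrictions_mono finite_restrictions[OF finite_cube]]) blast
    ultimately have "real (card (restrictions (cube ?n) W)) \<le> real (card (restrictions (cube ?n) ?Y))"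
      by (simp add: card_mono)
    also have "\<dots> \<le> exp (- real (card K) / real (card A ^ card (cube M :: (int^'d) set)))
       * real (card (restrictions (cube ?n) X))"
      by (rule card_avoiding_le[OF replace T \<open>N \<le> M\<close> K(1-3)])
    finally have "ln (real (card (restrictions (cube ?n) W)))
        \<le> ln (exp (- real (card K) / real (card A ^ card (cube M :: (int^'d) set)))
       * real (card (restrictions (cube ?n) X)))"
      using W.card_restrictions_pos[OF finite_cube] by (intro ln_mono) auto
    also have "\<dots> = - real (card K) / real (card A ^ card (cube M :: (int^'d) set))
        + ln (real (card (restrictions (cube ?n) X)))"
      using card_restrictions_pos[OF finite_cube, of ?n] by (subst ln_mult) auto
    also have "\<dots> \<le> - (a * ?cc n) + ln (real (card (restrictions (cube ?n) X)))"
    proof -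
      have "?cc n \<le> real (card K) * ?cc M" using K(4) by (metis of_nat_le_iff of_nat_mult)
      then have "?cc n / ?cc M \<le> real (card K)" using cc_pos by (subst pos_divide_le_eq) auto
      then have "?cc n / ?cc M / real (card A ^ card (cube M :: (int^'d) set))
          \<le> real (card K) / real (card A ^ card (cube M :: (int^'d) set))"
        using cA by (intro divide_right_mono) auto
      then show ?thesis unfolding a_def by (simp add: mult.commute)
    qed
    finally have "W.rate ?n \<le> (- (a * ?cc n) + ln (real (card (restrictions (cube ?n) X)))) / ?cc ?n"
      unfolding W.rate_def by (rule divide_right_mono) simp
    then show ?thesis unfolding rate_def by (simp add: add_divide_distrib diff_divide_distrib)
  qed
  have "(\<lambda>n. rate (n + (M + M)) - a * (?cc n / ?cc (n + (M + M)))) \<longlonglongrightarrow> h_top X - a * 1"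
  proof (intro tendsto_diff tendsto_mult tendsto_const)
    show "(\<lambda>n. rate (n + (M + M))) \<longlonglongrightarrow> h_top X"
      by (rule LIMSEQ_ignore_initial_segment[OF rate_tendsto])
    have "(\<lambda>n. inverse (?cc (n + (M + M)) / ?cc n)) \<longlonglongrightarrow> inverse 1"
      by (intro tendsto_inverse card_cube_ratio_tendsto) simp
    then show "(\<lambda>n. ?cc n / ?cc (n + (M + M))) \<longlonglongrightarrow> 1" by simp
  qed
  moreover have "(\<lambda>n. W.rate (n + (M + M))) \<longlonglongrightarrow> h_top W"
    by (rule LIMSEQ_ignore_initial_segment[OF W.rate_tendsto])
  ultimately have "h_top W \<le> h_top X - a * 1"
    using le by (intro LIMSEQ_le) auto
  then show ?thesis using a_pos by simp
qed

end

section \<open>The full extension and gluing along lines\<close>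

context shift_along_lattice
begin

abbreviation "Y \<equiv> full_extension A L L' (restrictions L X)"

lemma subset_full_extension: "X \<subseteq> Y"
proof
  fix x assume x: "x \<in> X"
  show "x \<in> Y"
    unfolding full_extension_iff
  proof (intro conjI ballI)
    show "range x \<subseteq> A" using x in_alphabet by blast
    fix w
    have "\<forall>j. x (j *s u + w) = shift w x (j *s u)" by (simp add: shift_def add.commute)
    then show "\<exists>z\<in>X. \<forall>j. x (j *s u + w) = z (j *s u)" using shift_closed[OF x] by blast
  qed
qed

text \<open>Shifting by \<open>i\<close> permutes the lines by \<open>p i\<close> and translates
  along them by \<open>c i\<close>. Line \<open>w\<close> of the shifted configuration is thus line
  \<open>p i + w\<close> of \<open>y\<close>, moved along \<open>u\<close>.\<close>

lemma shift_full_extension: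
  assumes "y \<in> Y"
  shows "shift i y \<in> Y"
  unfolding full_extension_iff
proof (intro conjI ballI)
  show "range (shift i y) \<subseteq> A" using assms unfolding full_extension_iff shift_def by blast
  fix w assume "w \<in> L'"
  then have "p i + w \<in> L'" using add_closed p_in by blast
  then obtain z where z: "z \<in> X" "\<forall>j. y (j *s u + (p i + w)) = z (j *s u)"
    using assms unfolding full_extension_iff by blast
  have "shift i y (j *s u + w) = shift (c i *s u) z (j *s u)" for j
  proof -
    have "i + (j *s u + w) = (c i *s u + p i) + (j *s u + w)" by (simp only: decomp)
    also have "\<dots> = (c i + j) *s u + (p i + w)"
      by (simp only: int_vec.scale_left_distrib ac_simps)
    finally have "shift i y (j *s u + w) = y ((c i + j) *s u + (p i + w))"
      unfolding shift_def by (rule arg_cong)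
    also have "\<dots> = z ((c i + j) *s u)" using z(2) by blast
    also have "\<dots> = shift (c i *s u) z (j *s u)"
      by (simp add: shift_def int_vec.scale_left_distrib)
    finally show ?thesis .
  qed
  then show "\<exists>z\<in>X. \<forall>j. shift i y (j *s u + w) = z (j *s u)"
    using shift_closed[OF z(1)] by blast
qed

lemma full_extension_on_line: "y \<in> Y \<Longrightarrow> \<exists>z\<in>X. \<forall>j. y (j *s u) = z (j *s u)"
  unfolding full_extension_iff using zero_in by fastforce

text \<open>Consequently \<open>X\<close> and \<open>Y\<close> have the same projectional entropy.
  Only the line through \<open>0\<close> is involved.\<close>

lemma restrictions_full_extension: "restrictions L Y = restrictions L X"
proof
  show "restrictions L X \<subseteq> restrictions L Y"
    using subset_full_extension by (rule restrictions_mono)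
  show "restrictions L Y \<subseteq> restrictions L X"
  proof
    fix q assume "q \<in> restrictions L Y"
    then obtain y where y: "y \<in> Y" "q = restrict y L" by (rule restrictionsE)
    then obtain z where "z \<in> X" "\<forall>j. y (j *s u) = z (j *s u)"
      using full_extension_on_line by blast
    then have "z \<in> X" "q = restrict z L" using y(2) by (simp_all add: restrict_eq_iff L_eq)
    then show "q \<in> restrictions L X" by (simp add: restrictionsI)
  qed
qed

lemma shift_along_lattice_full_extension: "shift_along_lattice A Y u L L' c p"
proof
  show "Y \<noteq> {}" using nonempty subset_full_extension by blast
  show "y i \<in> A" if "y \<in> Y" for y i using that unfolding full_extension_iff by blast
qed (use finite_alphabet shift_full_extension in auto)

text \<open>Block gluing speaks about blocks only, so a segment of \<open>L\<close> is enlarged to its bounding block.\<close>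

definition segment_box :: "int \<Rightarrow> int \<Rightarrow> (int^'d) set" where
  "segment_box a b = block (\<chi> k. min (a * u $ k) (b * u $ k)) (\<chi> k. max (a * u $ k) (b * u $ k))"

lemma segment_in_box:
  assumes "a \<le> j" "j \<le> b"
  shows "j *s u \<in> segment_box a b"
proof -
  have "min (a * u $ k) (b * u $ k) \<le> j * u $ k \<and> j * u $ k \<le> max (a * u $ k) (b * u $ k)" for k
  proof (cases "u $ k \<ge> 0")
    case True
    then have "a * u $ k \<le> j * u $ k" "j * u $ k \<le> b * u $ k"
      using assms by (auto intro: mult_right_mono)
    then show ?thesis by linarith
  next
    case False
    then have "b * u $ k \<le> j * u $ k" "j * u $ k \<le> a * u $ k"
      using assms by (auto intro: mult_right_mono_neg)
    then show ?thesis by linarith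
  qed
  then show ?thesis unfolding segment_box_def block_def by simp
qed

text \<open>One coordinate with \<open>u $ k \<noteq> 0\<close> suffices in the maximum norm. By
  integrality its modulus is at least 1, so a parameter gap larger than \<open>g\<close> remains
  larger than \<open>g\<close> in that coordinate.\<close>

lemma max_dist_segment_box:
  assumes "a \<le> b" "b + int g < c'" "c' \<le> d"
  shows "enat g < max_dist (segment_box a b) (segment_box c' d)"
proof -
  obtain k where k: "u $ k \<noteq> 0" using u_nonzero by (auto simp: vec_eq_iff)
  have "Suc g \<le> max_norm (i - j)" if ij: "i \<in> segment_box a b" "j \<in> segment_box c' d" for i j
  proof -
    have i: "min (a * u $ k) (b * u $ k) \<le> i $ k" "i $ k \<le> max (a * u $ k) (b * u $ k)"
      and j: "min (c' * u $ k) (d * u $ k) \<le> j $ k" "j $ k \<le> max (c' * u $ k) (d * u $ k)"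
      using ij unfolding segment_box_def block_def by simp_all
    have gap: "int g + 1 \<le> c' - b" "0 \<le> c' - b" using assms by linarith+
    have "int g + 1 \<le> \<bar>(i - j) $ k\<bar>"
    proof (cases "u $ k > 0")
      case True
      then have "a * u $ k \<le> b * u $ k" "c' * u $ k \<le> d * u $ k"
        using assms by (auto intro: mult_right_mono)
      then have "i $ k \<le> b * u $ k" "c' * u $ k \<le> j $ k" using i(2) j(1) by simp_all
      moreover have "(int g + 1) * 1 \<le> (c' - b) * u $ k"
        using True by (intro mult_mono gap) simp_all
      then have "b * u $ k + (int g + 1) \<le> c' * u $ k" by (simp add: left_diff_distrib)
      ultimately have "int g + 1 \<le> j $ k - i $ k" by linarith
      then show ?thesis by simp
    next
      case False
      then have "b * u $ k \<le> a * u $ k" "d * u $ k \<le> c' * u $ k"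
        using assms by (auto intro: mult_right_mono_neg)
      then have "b * u $ k \<le> i $ k" "j $ k \<le> c' * u $ k" using i(1) j(2) by simp_all
      moreover have "1 \<le> - (u $ k)" using False k by linarith
      then have "(int g + 1) * 1 \<le> (c' - b) * - (u $ k)"
        by (intro mult_mono gap) simp_all
      then have "c' * u $ k + (int g + 1) \<le> b * u $ k"
        by (simp add: left_diff_distrib)
      ultimately have "int g + 1 \<le> i $ k - j $ k" by linarith
      then show ?thesis by simp
    qed
    also have "\<bar>(i - j) $ k\<bar> \<le> int (max_norm (i - j))"
      using mem_cube[of "i - j" "max_norm (i - j)"] by (auto simp: cube_def)
    finally show ?thesis by linarith
  qed
  \<comment> \<open>The distance is an infimum, so the uniform bound \<open>Suc g\<close> is what
    yields the strict inequality.\<close>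
  then have "enat (Suc g) \<le> max_dist (segment_box a b) (segment_box c' d)"
    unfolding max_dist_def by (intro INF_greatest) auto
  then show ?thesis by (metis Suc_ile_eq)
qed

text \<open>A segment of \<open>z\<close> is inserted into \<open>x\<close> by gluing twice, once on
  each side. The window \<open>m\<close> appears because gluing concerns finite blocks only.\<close>

lemma glue_segments:
  assumes "block_gluing X"
  obtains g :: nat where "\<And>x z a b m. x \<in> X \<Longrightarrow> z \<in> X \<Longrightarrow> a \<le> b \<Longrightarrow>
      \<exists>y\<in>X. (\<forall>j. a \<le> j \<and> j \<le> b \<longrightarrow> y (j *s u) = z (j *s u)) \<and>
        (\<forall>j. \<bar>j\<bar> \<le> m \<and> (j < a - int g \<or> b + int g < j) \<longrightarrow> y (j *s u) = x (j *s u))"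
proof -
  obtain g where g: "\<And>u1 v1 u2 v2 P1 P2. enat g < max_dist (block u1 v1) (block u2 v2) \<Longrightarrow>
        P1 \<in> restrictions (block u1 v1) X \<Longrightarrow> P2 \<in> restrictions (block u2 v2) X \<Longrightarrow>
           \<exists>x\<in>X. restrict x (block u1 v1) = P1 \<and> restrict x (block u2 v2) = P2"
    using assms unfolding block_gluing_def by metis
  have two: "\<exists>y\<in>X. (\<forall>j. a \<le> j \<and> j \<le> b \<longrightarrow> y (j *s u) = x (j *s u)) \<and>
      (\<forall>j. c' \<le> j \<and> j \<le> d \<longrightarrow> y (j *s u) = z (j *s u))"
    if xz: "x \<in> X" "z \<in> X" and ab: "a \<le> b" "b + int g < c'" "c' \<le> d" for x z a b c' d
  proof -
    have "restrict x (segment_box a b) \<in> restrictions (segment_box a b) X"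
      "restrict z (segment_box c' d) \<in> restrictions (segment_box c' d) X"
      using xz by (simp_all add: restrictionsI)
    then obtain y where "y \<in> X" "restrict y (segment_box a b) = restrict x (segment_box a b)"
        "restrict y (segment_box c' d) = restrict z (segment_box c' d)"
      using g max_dist_segment_box[OF ab] unfolding segment_box_def by blast
    then show ?thesis unfolding restrict_eq_iff using segment_in_box by blast
  qed
  have "\<exists>y\<in>X. (\<forall>j. a \<le> j \<and> j \<le> b \<longrightarrow> y (j *s u) = z (j *s u)) \<and>
        (\<forall>j. \<bar>j\<bar> \<le> m \<and> (j < a - int g \<or> b + int g < j) \<longrightarrow> y (j *s u) = x (j *s u))"
    if xz: "x \<in> X" "z \<in> X" and ab: "a \<le> b" for x z a b m
  proof -
    \<comment> \<open>The bounds reach past the gaps even for small \<open>m\<close>, so that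
      neither outer segment is empty.\<close>
    let ?lo = "min (- m) (a - int g - 1)" and ?hi = "max m (b + int g + 1)"
    have lo: "?lo \<le> a - int g - 1" "a - int g - 1 + int g < a" by simp_all
    obtain y1 where y1: "y1 \<in> X" "\<forall>j. ?lo \<le> j \<and> j \<le> a - int g - 1 \<longrightarrow> y1 (j *s u) = x (j *s u)"
        "\<forall>j. a \<le> j \<and> j \<le> b \<longrightarrow> y1 (j *s u) = z (j *s u)"
      using two[OF xz lo ab] by blast
    have hi: "?lo \<le> b" "b + int g < b + int g + 1" "b + int g + 1 \<le> ?hi"
      using ab by linarith+
    \<comment> \<open>The left part and the middle of \<open>y1\<close> now form one segment, to
      which the right part of \<open>x\<close> is glued.\<close>
    obtain y2 where y2: "y2 \<in> X" "\<forall>j. ?lo \<le> j \<and> j \<le> b \<longrightarrow> y2 (j *s u) = y1 (j *s u)"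
        "\<forall>j. b + int g + 1 \<le> j \<and> j \<le> ?hi \<longrightarrow> y2 (j *s u) = x (j *s u)"
      using two[OF y1(1) xz(1) hi] by blast
    have "y2 (j *s u) = z (j *s u)" if "a \<le> j" "j \<le> b" for j
      using y1(3) y2(2) that by simp
    moreover have "y2 (j *s u) = x (j *s u)" if j: "\<bar>j\<bar> \<le> m" "j < a - int g \<or> b + int g < j" for j
      using j(2)
    proof
      assume "j < a - int g"
      then have "?lo \<le> j \<and> j \<le> a - int g - 1" "?lo \<le> j \<and> j \<le> b"
        using j(1) \<open>a \<le> b\<close> by linarith+
      then show ?thesis using y1(2) y2(2) by metis
    next
      assume "b + int g < j"
      then have "b + int g + 1 \<le> j \<and> j \<le> ?hi" using j(1) by linarith
      then show ?thesis using y2(3) by blast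
    qed
    ultimately show ?thesis using y2(1) by blast
  qed
  then show ?thesis using that by blast
qed

text \<open>In \<open>Y\<close> the lines can be altered independently, so it suffices to glue
  inside \<open>X\<close> on each line. The margin \<open>r\<close> contains the gap of length
  \<open>g\<close> along \<open>u\<close> and is the same for all \<open>N\<close>, \<open>t\<close>
  and \<open>n\<close>.\<close>

lemma replace_pattern:
  assumes "block_gluing X"
  obtains r where "\<And>y y0 t n N. y \<in> Y \<Longrightarrow> y0 \<in> Y \<Longrightarrow>
      \<exists>y'\<in>Y. (\<forall>i\<in>cube N. y' (t + i) = y0 i) \<and> (\<forall>i\<in>cube n. i - t \<notin> cube (N + r) \<longrightarrow> y' i = y i)"
proof -
  obtain g :: nat where g: "\<And>x z a b m. x \<in> X \<Longrightarrow> z \<in> X \<Longrightarrow> a \<le> b \<Longrightarrow>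
      \<exists>y\<in>X. (\<forall>j. a \<le> j \<and> j \<le> b \<longrightarrow> y (j *s u) = z (j *s u)) \<and>
        (\<forall>j. \<bar>j\<bar> \<le> m \<and> (j < a - int g \<or> b + int g < j) \<longrightarrow> y (j *s u) = x (j *s u))"
    using glue_segments[OF assms] by blast
  obtain r where r: "(\<lambda>j. j *s u) ` {- int g..int g} \<subseteq> cube r"
    using finite_subset_cube[of "(\<lambda>j. j *s u) ` {- int g..int g}"] by blast
  have "\<exists>y'\<in>Y. (\<forall>i\<in>cube N. y' (t + i) = y0 i) \<and> (\<forall>i\<in>cube n. i - t \<notin> cube (N + r) \<longrightarrow> y' i = y i)"
    if y: "y \<in> Y" and y0: "y0 \<in> Y" for y y0 t n N
  proof -
    \<comment> \<open>A window large enough to contain the parameters of all points of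
      \<open>cube n\<close>.\<close>
    define m where "m = Max (insert 0 ((\<lambda>i. \<bar>c i\<bar>) ` (cube n :: (int^'d) set)))"
    have m: "\<bar>c i\<bar> \<le> m" if "i \<in> cube n" for i
      unfolding m_def using that finite_cube[of n] by (intro Max_ge) auto
    have "\<exists>x\<in>X. (\<forall>j. j *s u + w - t \<in> cube N \<longrightarrow> x (j *s u) = y0 (j *s u + w - t)) \<and>
        (\<forall>j. j *s u + w \<in> cube n \<and> j *s u + w - t \<notin> cube (N + r) \<longrightarrow> x (j *s u) = y (j *s u + w))"
      if w: "w \<in> L'" for w
    proof -
      obtain x where x: "x \<in> X" "\<And>j. y (j *s u + w) = x (j *s u)"
        using y w unfolding full_extension_iff by blast
      \<comment> \<open>Shifting \<open>y0\<close> by \<open>- t\<close> moves its central pattern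
        to the position \<open>t\<close>.\<close>
      obtain z where z: "z \<in> X" "\<And>j. shift (- t) y0 (j *s u + w) = z (j *s u)"
        using shift_full_extension[OF y0, of "- t"] w unfolding full_extension_iff by blast
      have z': "y0 (j *s u + w - t) = z (j *s u)" for j
        using z(2)[of j] by (simp add: shift_def)
      show ?thesis
      proof (cases "\<exists>j. j *s u + w - t \<in> cube N")
        case False
        then show ?thesis using x by auto
      next
        case True
        have ne: "{j. j *s u + (w - t) \<in> cube N} \<noteq> {}" using True by (simp add: add_diff_eq)
        obtain a b where "a \<le> b" and I: "{j. j *s u + (w - t) \<in> cube N} = {a..b}"
          by (rule segment_eq_cube_line[OF ne])
        have in_cube: "j *s u + w - t \<in> cube N \<longleftrightarrow> a \<le> j \<and> j \<le> b" for j
        proof -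
          have "j *s u + (w - t) \<in> cube N \<longleftrightarrow> j \<in> {a..b}" using I by blast
          then show ?thesis by (simp add: add_diff_eq)
        qed
        obtain x' where x': "x' \<in> X" "\<And>j. a \<le> j \<Longrightarrow> j \<le> b \<Longrightarrow> x' (j *s u) = z (j *s u)"
            "\<And>j. \<bar>j\<bar> \<le> m \<Longrightarrow> j < a - int g \<or> b + int g < j \<Longrightarrow> x' (j *s u) = x (j *s u)"
          using g[OF x(1) z(1) \<open>a \<le> b\<close>, of m] by blast
        have "j < a - int g \<or> b + int g < j" if j: "j *s u + w - t \<notin> cube (N + r)" for j
        proof (rule ccontr)
          assume "\<not> (j < a - int g \<or> b + int g < j)"
          \<comment> \<open>The witness is the point of the interval nearest to \<open>j\<close>, at
            distance at most \<open>g\<close>.\<close>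
          then have "a \<le> max a (min b j)" "max a (min b j) \<le> b" "\<bar>j - max a (min b j)\<bar> \<le> int g"
            using \<open>a \<le> b\<close> by linarith+
          then obtain j' where j': "a \<le> j'" "j' \<le> b" "\<bar>j - j'\<bar> \<le> int g" by blast
          then have "j - j' \<in> {- int g..int g}" by auto
          then have "(j - j') *s u \<in> cube r" using r by blast
          moreover have "j' *s u + w - t \<in> cube N" using in_cube j' by blast
          ultimately have "(j' *s u + w - t) + (j - j') *s u \<in> cube (N + r)" by (intro cube_add)
          then show False using j by (simp add: algebra_simps)
        qed
        moreover have "\<bar>j\<bar> \<le> m" if "j *s u + w \<in> cube n" for j
          using m[OF that] c_line[OF w, of j] by simp
        ultimately show ?thesis
          using x' in_cube x(2) z' by (intro bexI[of _ x']) auto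
      qed
    qed
    then obtain f where f: "\<And>w. w \<in> L' \<Longrightarrow> f w \<in> X"
        "\<And>w j. w \<in> L' \<Longrightarrow> j *s u + w - t \<in> cube N \<Longrightarrow> f w (j *s u) = y0 (j *s u + w - t)"
        "\<And>w j. w \<in> L' \<Longrightarrow> j *s u + w \<in> cube n \<Longrightarrow> j *s u + w - t \<notin> cube (N + r) \<Longrightarrow>
          f w (j *s u) = y (j *s u + w)"
      by metis
    define y' where "y' i = f (p i) (c i *s u)" for i
    have "y' \<in> Y"
      unfolding full_extension_iff
    proof (intro conjI ballI)
      show "range y' \<subseteq> A" unfolding y'_def using f(1) p_in in_alphabet by auto
      fix w assume w: "w \<in> L'"
      then have "\<forall>j. y' (j *s u + w) = f w (j *s u)"
        unfolding y'_def by (simp add: c_line p_line)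
      then show "\<exists>z\<in>X. \<forall>j. y' (j *s u + w) = z (j *s u)" using f(1)[OF w] by blast
    qed
    moreover have "y' (t + i) = y0 i" if "i \<in> cube N" for i
      using f(2)[OF p_in, of "c (t + i)" "t + i"] that by (simp add: decomp y'_def)
    moreover have "y' i = y i" if "i \<in> cube n" "i - t \<notin> cube (N + r)" for i
      using f(3)[OF p_in, of "c i" i] that by (simp add: decomp y'_def)
    ultimately show ?thesis by blast
  qed
  then show ?thesis by (rule that)
qed

end

section \<open>Closedness, and the equivalence\<close>

text \<open>The complement of \<open>X\<close> contains a basic open set around \<open>y\<close>,
  which constrains finitely many coordinates. Some cube contains them all, so the pattern of
  \<open>y\<close> on that cube never occurs in \<open>X\<close>.\<close>

lemma not_in_closed_shift:
  assumes "is_shift A X" "y \<notin> X" "range y \<subseteq> A"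
  obtains N where "\<And>x. x \<in> X \<Longrightarrow> \<exists>i\<in>cube N. x i \<noteq> y i"
proof -
  let ?P = "product_topology (\<lambda>_. discrete_topology A) UNIV :: (int^'d \<Rightarrow> 'a) topology"
  have "openin ?P (topspace ?P - X)" using assms(1) unfolding is_shift_def by blast
  moreover have "y \<in> topspace ?P - X" using assms(2,3) by auto
  ultimately obtain U where U: "finite {i. U i \<noteq> A}" "y \<in> PiE UNIV U" "PiE UNIV U \<subseteq> topspace ?P - X"
    unfolding openin_product_topology_alt by (auto simp: Ball_def)
  obtain N where N: "{i. U i \<noteq> A} \<subseteq> cube N" using finite_subset_cube[OF U(1)] by blast
  have "\<exists>i\<in>cube N. x i \<noteq> y i" if x: "x \<in> X" for x
  proof (rule ccontr)
    assume eq: "\<not> (\<exists>i\<in>cube N. x i \<noteq> y i)"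
    have "x i \<in> U i" for i
    proof (cases "i \<in> cube N")
      case True
      then have "x i = y i" using eq by blast
      then show ?thesis using U(2) by (simp add: PiE_iff)
    next
      case False
      then have "U i = A" using N by blast
      moreover have "X \<subseteq> topspace ?P" using assms(1) closedin_subset unfolding is_shift_def by blast
      ultimately show ?thesis using x by (auto simp: PiE_iff)
    qed
    then have "x \<in> PiE UNIV U" by (simp add: PiE_iff)
    then show False using U(3) x by blast
  qed
  then show ?thesis using that by blast
qed

theorem theorem2p5:
  fixes A :: "'a set" and X :: "(int^'d \<Rightarrow> 'a) set"
    and u :: "int^'d" and L L' :: "(int^'d) set"
  assumes "CARD('d) \<ge> 2"
    and "finite A"
    and "is_shift A X"
    and "block_gluing X"
    and "complementary_sublattices u L L'"
  shows "h_top X = proj_entropy u L X \<longleftrightarrow> X = full_extension A L L' (restrictions L X)"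
proof (cases "X = {}")
  case True
  obtain c p where "lattice_splitting u L L' c p"
    using complementary_sublattices_splitting[OF assms(5)] by blast
  \<comment> \<open>For empty \<open>X\<close> both entropies agree since both pattern sets are
    empty, and the full extension is empty because \<open>L'\<close> provides a line on which no
    element of \<open>X\<close> can be matched.\<close>
  then have "L' \<noteq> {}" using lattice_splitting.zero_in by blast
  then show ?thesis
    using True by (auto simp: full_extension_def restrictions_def proj_entropy_def as_Z_shift_def h_top_def)
next
  case False
  obtain c p where split: "lattice_splitting u L L' c p"
    using complementary_sublattices_splitting[OF assms(5)] by blast
  have inv: "invariant_configurations A X"
  proof
    show "x i \<in> A" if "x \<in> X" for x i
      using closedin_subset[of _ X] assms(3) that unfolding is_shift_def by fastforce
  qed (use assms(2,3) False in \<open>auto simp: is_shift_def\<close>)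
  interpret X: shift_along_lattice A X u L L' c p
    using inv split by (rule shift_along_lattice.intro)
  interpret Y: shift_along_lattice A X.Y u L L' c p
    by (rule X.shift_along_lattice_full_extension)
  show ?thesis
  proof
    assume eq: "h_top X = proj_entropy u L X"
    show "X = X.Y"
    proof (rule ccontr)
      assume "X \<noteq> X.Y"
      then obtain y0 where y0: "y0 \<in> X.Y" "y0 \<notin> X" using X.subset_full_extension by blast
      then have "range y0 \<subseteq> A" unfolding X.full_extension_iff by blast
      then obtain N where N: "\<And>x. x \<in> X \<Longrightarrow> \<exists>i\<in>cube N. x i \<noteq> y0 i"
        using not_in_closed_shift[OF assms(3) y0(2)] by blast
      obtain r where r: "\<And>y y0 t n N. y \<in> X.Y \<Longrightarrow> y0 \<in> X.Y \<Longrightarrow>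
          \<exists>y'\<in>X.Y. (\<forall>i\<in>cube N. y' (t + i) = y0 i) \<and>
            (\<forall>i\<in>cube n. i - t \<notin> cube (N + r) \<longrightarrow> y' i = y i)"
        using X.replace_pattern[OF assms(4)] by metis
      \<comment> \<open>The full extension is the ambient system, \<open>X\<close> the subsystem
        avoiding the pattern of \<open>y0\<close>, and \<open>N + r\<close> the radius of the
        altered region.\<close>
      have "h_top X < h_top X.Y"
        using inv X.subset_full_extension N r[OF _ y0(1)]
        by (rule Y.h_top_less) (assumption | rule le_add1)+
      also have "\<dots> \<le> proj_entropy u L X.Y" by (rule Y.h_top_le_proj_entropy)
      also have "\<dots> = proj_entropy u L X"
        unfolding proj_entropy_def by (simp only: X.restrictions_full_extension)
      finally show False using eq by simp
    qed
  next
    assume "X = X.Y"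
    then have "proj_entropy u L X \<le> h_top X" by (rule X.proj_entropy_le_h_top)
    then show "h_top X = proj_entropy u L X" using X.h_top_le_proj_entropy by linarith
  qed
qed

end
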